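(* For every $n\ge 2$, the complex algebra $p_n^{+}$ degenerates to $\lambda_2\oplus a_{n-2}$; and for every $n\geq 3$, the complex algebra $n_3^{+}\oplus a_{n-3}$ degenerates to $\lambda_2\oplus a_{n-2}$.
   Context: An $n$-dimensional algebra over $\mathbb{C}$ is an $n$-dimensional complex vector space $V$ with an arbitrary bilinear map $\lambda: V\times V\to V$ (no identities are assumed), i.e. a point $\lambda$ of the $n^3$-dimensional affine space $\mathrm{Hom}(V\otimes V,V)$. The group $GL_n(\mathbb{C})=GL(V)$ acts by $(g*\lambda)(x,y)=g(\lambda(g^{-1}(x),g^{-1}(y)))$; the orbit $Orb(\lambda)$ is the isomorphism class of $\lambda$. For $n$-dimensional complex algebras $\lambda,\mu$, we say $\lambda$ degenerates to $\mu$, written $\lambda\to\mu$, if $Orb(\mu)$ lies in the Zariski closure of $Orb(\lambda)$ in $\mathrm{Hom}(V\otimes V,V)$. Notation (all products of basis vectors not listed are zero; $\oplus$ is the direct sum of algebras; $a_m$ is the $m$-dimensional algebra with zero multiplication, with $a_0=0$): - $p_n^{+}$: basis $e_1,\dots,e_n$, with $e_1e_i=e_i$, $e_ie_1=e_i$ for $2\le i\le n$. - $n_3^{+}$: basis $e_1,e_2,e_3$, with $e_1e_2=e_3$, $e_2e_1=e_3$. - $\lambda_2$: basis $e_1,e_2$, with $e_1e_1=e_2$. *)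

theory Defs
  imports "Jordan_Normal_Form.Gauss_Jordan_Elimination" "HOL-Library.FuncSet"
begin

text \<open>
  The underlying vector space of an \<open>n\<close>-dimensional algebra is \<open>\<complex>\<^sup>n\<close>, i.e. \<^term>\<open>carrier_vec n\<close>.
  Indices are shifted by one: the basis vector \<open>e\<^sub>i\<close> is \<^term>\<open>unit_vec n (i - 1)\<close>.
\<close>

type_synonym mult = "complex vec \<Rightarrow> complex vec \<Rightarrow> complex vec"

text \<open>
  The space \<open>Hom(V \<otimes> V, V)\<close>. Multiplications are extensional outside \<open>\<complex>\<^sup>n\<close>, so that HOL equality
  of elements is equality of bilinear maps.
\<close>

definition algebras :: "nat \<Rightarrow> mult set" where
  "algebras n = {A \<in> carrier_vec n \<rightarrow>\<^sub>E carrier_vec n \<rightarrow>\<^sub>E carrier_vec n.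
     (\<forall>x \<in> carrier_vec n. \<forall>y \<in> carrier_vec n. \<forall>z \<in> carrier_vec n.
        A (x + y) z = A x z + A y z \<and> A x (y + z) = A x y + A x z) \<and>
     (\<forall>c. \<forall>x \<in> carrier_vec n. \<forall>y \<in> carrier_vec n.
        A (c \<cdot>\<^sub>v x) y = c \<cdot>\<^sub>v A x y \<and> A x (c \<cdot>\<^sub>v y) = c \<cdot>\<^sub>v A x y)}"

definition GL :: "nat \<Rightarrow> complex mat set" where
  "GL n = {g \<in> carrier_mat n n. invertible_mat g}"

definition GL_act :: "nat \<Rightarrow> complex mat \<Rightarrow> mult \<Rightarrow> mult" where
  "GL_act n g A = (\<lambda>x \<in> carrier_vec n. \<lambda>y \<in> carrier_vec n.
     g *\<^sub>v A (the (mat_inverse g) *\<^sub>v x) (the (mat_inverse g) *\<^sub>v y))"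

definition Orb :: "nat \<Rightarrow> mult \<Rightarrow> mult set" where
  "Orb n A = (\<lambda>g. GL_act n g A) ` GL n"

text \<open>
  Polynomial functions on \<open>Hom(V \<otimes> V, V)\<close>: polynomial expressions in the \<open>n\<^sup>3\<close> structure constants,
  which are the coordinates of this affine space.
\<close>

inductive_set poly_funs :: "nat \<Rightarrow> (mult \<Rightarrow> complex) set" for n :: nat where
  const: "(\<lambda>A. c) \<in> poly_funs n"
| coord: "i < n \<Longrightarrow> j < n \<Longrightarrow> k < n \<Longrightarrow>
    (\<lambda>A. A (unit_vec n i) (unit_vec n j) $ k) \<in> poly_funs n"
| add: "p \<in> poly_funs n \<Longrightarrow> q \<in> poly_funs n \<Longrightarrow> (\<lambda>A. p A + q A) \<in> poly_funs n"
| mult: "p \<in> poly_funs n \<Longrightarrow> q \<in> poly_funs n \<Longrightarrow> (\<lambda>A. p A * q A) \<in> poly_funs n"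

definition zariski_closed :: "nat \<Rightarrow> mult set \<Rightarrow> bool" where
  "zariski_closed n Z \<longleftrightarrow> (\<exists>P \<subseteq> poly_funs n. Z = {A \<in> algebras n. \<forall>p \<in> P. p A = 0})"

definition zariski_closure :: "nat \<Rightarrow> mult set \<Rightarrow> mult set" where
  "zariski_closure n S = zariski_closed n hull S"

definition degenerates :: "nat \<Rightarrow> mult \<Rightarrow> mult \<Rightarrow> bool" where
  "degenerates n A B \<longleftrightarrow>
     A \<in> algebras n \<and> B \<in> algebras n \<and> Orb n B \<subseteq> zariski_closure n (Orb n A)"

text \<open>The multiplication with \<open>e\<^sub>i e\<^sub>j = c i j\<close> (indices from \<open>0\<close>), extended bilinearly.\<close>

definition mult_of_table :: "nat \<Rightarrow> (nat \<Rightarrow> nat \<Rightarrow> complex vec) \<Rightarrow> mult" where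
  "mult_of_table n c = (\<lambda>x \<in> carrier_vec n. \<lambda>y \<in> carrier_vec n.
     vec n (\<lambda>k. \<Sum>i<n. \<Sum>j<n. x $ i * y $ j * c i j $ k))"

definition zero_algebra :: "nat \<Rightarrow> mult" where
  "zero_algebra m = (\<lambda>x \<in> carrier_vec m. \<lambda>y \<in> carrier_vec m. 0\<^sub>v m)"

definition direct_sum :: "nat \<Rightarrow> nat \<Rightarrow> mult \<Rightarrow> mult \<Rightarrow> mult" where
  "direct_sum m k A B = (\<lambda>x \<in> carrier_vec (m + k). \<lambda>y \<in> carrier_vec (m + k).
     A (vec_first x m) (vec_first y m) @\<^sub>v B (vec_last x k) (vec_last y k))"

definition p_plus :: "nat \<Rightarrow> mult" where
  "p_plus n = mult_of_table n (\<lambda>i j.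
     if i = 0 \<and> 1 \<le> j then unit_vec n j
     else if 1 \<le> i \<and> j = 0 then unit_vec n i
     else 0\<^sub>v n)"

definition n3_plus :: mult where
  "n3_plus = mult_of_table 3 (\<lambda>i j.
     if (i = 0 \<and> j = 1) \<or> (i = 1 \<and> j = 0) then unit_vec 3 2 else 0\<^sub>v 3)"

definition lambda2 :: mult where
  "lambda2 = mult_of_table 2 (\<lambda>i j. if i = 0 \<and> j = 0 then unit_vec 2 1 else 0\<^sub>v 2)"

end

theory Submission
  imports Defs "Jordan_Normal_Form.Determinant"
begin

text \<open>
  Since polynomials are continuous, the Zariski closure of an orbit contains every limit of points of
  the orbit in the Euclidean topology. In \<open>p\<^sub>n\<^sup>+\<close> the basis
  \<open>f\<^sub>1 = t e\<^sub>1 + (2t)\<^sup>-\<^sup>1 e\<^sub>2\<close>, \<open>f\<^sub>i = e\<^sub>i\<close> satisfies \<open>f\<^sub>1 f\<^sub>1 = f\<^sub>2\<close>,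
  while \<open>f\<^sub>1 f\<^sub>i = f\<^sub>i f\<^sub>1 = t f\<^sub>i\<close> vanishes as \<open>t \<rightarrow> 0\<close>. In \<open>n\<^sub>3\<^sup>+\<close> the basis
  \<open>f\<^sub>1 = e\<^sub>1 + e\<^sub>2 / 2\<close>, \<open>f\<^sub>2 = e\<^sub>3\<close>, \<open>f\<^sub>3 = t e\<^sub>2\<close> satisfies \<open>f\<^sub>1 f\<^sub>1 = f\<^sub>2\<close> and
  \<open>f\<^sub>1 f\<^sub>3 = f\<^sub>3 f\<^sub>1 = t f\<^sub>2\<close>.
\<close>

section \<open>Orbits\<close>

text \<open>An inverse makes \<open>g\<close> a unit of the matrix ring, which rules out
  \<open>None\<close> as the result of Gauss-Jordan elimination. So the
  \<open>the (mat_inverse g)\<close> inside \<open>GL_act\<close> is the genuine inverse.\<close>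

lemma GL_inverse:
  assumes "g \<in> GL n"
  shows "the (mat_inverse g) \<in> carrier_mat n n"
    and "g * the (mat_inverse g) = 1\<^sub>m n"
    and "the (mat_inverse g) * g = 1\<^sub>m n"
proof -
  have g: "g \<in> carrier_mat n n" and "invertible_mat g"
    using assms by (auto simp: GL_def)
  then obtain h where h: "g * h = 1\<^sub>m n" "h * g = 1\<^sub>m (dim_row h)"
    by (auto simp: invertible_mat_def inverts_mat_def)
  \<comment> \<open>\<open>invertible_mat\<close> leaves the shape of the inverse open; comparing
    column counts in the two product equations fixes it.\<close>
  have "dim_row h = n" "dim_col h = n"
    using arg_cong[OF h(1), of dim_col] arg_cong[OF h(2), of dim_col] g by auto
  then have "h \<in> carrier_mat n n" and "h * g = 1\<^sub>m n"
    using h by auto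
  then have "g \<in> Units (ring_mat TYPE(complex) n undefined)"
    using g h by (auto simp: Units_def ring_mat_simps)
  then obtain k where "mat_inverse g = Some k"
    using mat_inverse(1)[OF g, of undefined] by (cases "mat_inverse g") auto
  then show "the (mat_inverse g) \<in> carrier_mat n n"
    "g * the (mat_inverse g) = 1\<^sub>m n" "the (mat_inverse g) * g = 1\<^sub>m n"
    using mat_inverse(2)[OF g] by auto
qed

text \<open>For square matrices a right inverse is also a left inverse, and inverses are unique. A
  hand-written \<open>h\<close> can thus replace the output of the elimination algorithm.\<close>

lemma GL_I:
  assumes g: "g \<in> carrier_mat n n" and h: "h \<in> carrier_mat n n" and gh: "g * h = 1\<^sub>m n"
  shows "g \<in> GL n" and "the (mat_inverse g) = h"
proof -
  have hg: "h * g = 1\<^sub>m n"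
    by (rule mat_mult_left_right_inverse[OF g h gh])
  show G: "g \<in> GL n"
    using g h gh hg by (auto simp: GL_def invertible_mat_def inverts_mat_def)
  let ?k = "the (mat_inverse g)"
  have "?k = (h * g) * ?k"
    using GL_inverse[OF G] hg by simp
  also have "\<dots> = h * (g * ?k)"
    using GL_inverse(1)[OF G] g h by simp
  finally show "?k = h"
    using GL_inverse[OF G] h by simp
qed

lemma OrbI:
  assumes g: "g \<in> carrier_mat n n" and h: "h \<in> carrier_mat n n" and gh: "g * h = 1\<^sub>m n"
    and B: "B = (\<lambda>x \<in> carrier_vec n. \<lambda>y \<in> carrier_vec n. g *\<^sub>v A (h *\<^sub>v x) (h *\<^sub>v y))"
  shows "B \<in> Orb n A"
  using GL_I[OF g h gh] B by (auto simp: Orb_def GL_act_def)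

lemma algebras_closed:
  assumes "A \<in> algebras n" "x \<in> carrier_vec n" "y \<in> carrier_vec n"
  shows "A x y \<in> carrier_vec n"
  using assms by (auto simp: algebras_def PiE_iff)

lemma GL_act_algebras:
  assumes A: "A \<in> algebras n" and g: "g \<in> GL n"
  shows "GL_act n g A \<in> algebras n"
proof -
  let ?h = "the (mat_inverse g)"
  have h: "?h \<in> carrier_mat n n" and gc: "g \<in> carrier_mat n n"
    using GL_inverse[OF g] g by (auto simp: GL_def)
  have hc: "?h *\<^sub>v x \<in> carrier_vec n" if "x \<in> carrier_vec n" for x
    using h that by simp
  note closed = algebras_closed[OF A]
  have bilinear: "A (x + y) z = A x z + A y z" "A x (y + z) = A x y + A x z"
    "A (c \<cdot>\<^sub>v x) y = c \<cdot>\<^sub>v A x y" "A x (c \<cdot>\<^sub>v y) = c \<cdot>\<^sub>v A x y"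
    if "x \<in> carrier_vec n" "y \<in> carrier_vec n" "z \<in> carrier_vec n" for x y z c
    using A that by (auto simp: algebras_def)
  show ?thesis
    unfolding algebras_def GL_act_def
    using h gc hc closed
    by (auto simp: bilinear mult_add_distrib_mat_vec[OF h] mult_add_distrib_mat_vec[OF gc]
        mult_mat_vec[OF h] mult_mat_vec[OF gc])
qed

text \<open>Acting by \<open>h\<close> and then by \<open>g\<close> is acting by
  \<open>g * h\<close>, whose inverse is the product of the inverses in reverse order.\<close>

lemma GL_act_Orb:
  assumes A: "A \<in> algebras n" and g: "g \<in> GL n" and B: "B \<in> Orb n A"
  shows "GL_act n g B \<in> Orb n A"
proof -
  obtain h where h: "h \<in> GL n" and B: "B = GL_act n h A"
    using B by (auto simp: Orb_def)
  let ?g' = "the (mat_inverse g)" and ?h' = "the (mat_inverse h)"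
  note gi = GL_inverse[OF g] and hi = GL_inverse[OF h]
  have c: "g \<in> carrier_mat n n" "h \<in> carrier_mat n n"
    using g h by (auto simp: GL_def)
  have "g * h * (?h' * ?g') = g * ((h * ?h') * ?g')"
    using c gi(1) hi(1) by (simp add: assoc_mult_mat[of _ n n _ n _ n])
  also have "\<dots> = 1\<^sub>m n"
    using gi hi by simp
  finally have inv: "g * h * (?h' * ?g') = 1\<^sub>m n" .
  show ?thesis
  proof (rule OrbI[OF _ _ inv])
    show "GL_act n g B = (\<lambda>x \<in> carrier_vec n. \<lambda>y \<in> carrier_vec n.
        g * h *\<^sub>v A (?h' * ?g' *\<^sub>v x) (?h' * ?g' *\<^sub>v y))"
      using c gi(1) hi(1)
      by (auto simp: B GL_act_def fun_eq_iff restrict_def algebras_closed[OF A]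
          assoc_mult_mat_vec[of _ n n _ n])
  qed (use c gi(1) hi(1) in auto)
qed

section \<open>Limits of orbit points\<close>

lemma poly_funs_tendsto:
  assumes p: "p \<in> poly_funs n"
    and lim: "\<And>x y k. x \<in> carrier_vec n \<Longrightarrow> y \<in> carrier_vec n \<Longrightarrow> k < n \<Longrightarrow>
      ((\<lambda>t. C t x y $ k) \<longlongrightarrow> B x y $ k) F"
  shows "((\<lambda>t. p (C t)) \<longlongrightarrow> p B) F"
  using p
proof induction
  case (const c)
  show ?case
    by (rule tendsto_const)
next
  case (coord i j k)
  then show ?case
    by (intro lim) auto
next
  case (add p q)
  show ?case
    by (rule tendsto_add[OF add.IH])
next
  case (mult p q)
  show ?case
    by (rule tendsto_mult[OF mult.IH])
qed

text \<open>A polynomial vanishing on \<open>S\<close> is eventually zero along \<open>C\<close>, so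
  by continuity it also vanishes at the limit \<open>B\<close>; hence \<open>B\<close> satisfies the
  equations of every closed set containing \<open>S\<close>.\<close>

lemma tendsto_mem_zariski_closure:
  assumes F: "F \<noteq> bot" and B: "B \<in> algebras n" and C: "\<forall>\<^sub>F t in F. C t \<in> S"
    and lim: "\<And>x y k. x \<in> carrier_vec n \<Longrightarrow> y \<in> carrier_vec n \<Longrightarrow> k < n \<Longrightarrow>
      ((\<lambda>t. C t x y $ k) \<longlongrightarrow> B x y $ k) F"
  shows "B \<in> zariski_closure n S"
  unfolding zariski_closure_def hull_def
proof safe
  fix Z assume "zariski_closed n Z" and "S \<subseteq> Z"
  then obtain P where P: "P \<subseteq> poly_funs n" and Z: "Z = {A \<in> algebras n. \<forall>p \<in> P. p A = 0}"
    by (auto simp: zariski_closed_def)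
  have "p B = 0" if "p \<in> P" for p
  proof (rule tendsto_unique[OF F])
    show "((\<lambda>t. p (C t)) \<longlongrightarrow> p B) F"
      by (rule poly_funs_tendsto[OF _ lim]) (use P that in auto)
    show "((\<lambda>t. p (C t)) \<longlongrightarrow> 0) F"
      using C \<open>S \<subseteq> Z\<close> Z that by (intro tendsto_eventually) (auto elim!: eventually_mono)
  qed
  then show "B \<in> Z"
    using B Z by simp
qed

text \<open>One curve suffices for the whole orbit of \<open>B\<close>: translating it by
  \<open>g\<close> keeps it in the orbit of \<open>A\<close>, and its limit becomes the translate of
  \<open>B\<close>, since the action is linear in the structure constants.\<close>

lemma degenerates_limit:
  assumes F: "F \<noteq> bot" and A: "A \<in> algebras n" and B: "B \<in> algebras n"
    and C: "\<forall>\<^sub>F t in F. C t \<in> Orb n A"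
    and lim: "\<And>x y k. x \<in> carrier_vec n \<Longrightarrow> y \<in> carrier_vec n \<Longrightarrow> k < n \<Longrightarrow>
      ((\<lambda>t. C t x y $ k) \<longlongrightarrow> B x y $ k) F"
  shows "degenerates n A B"
  unfolding degenerates_def
proof (intro conjI A B subsetI)
  fix D assume "D \<in> Orb n B"
  then obtain g where g: "g \<in> GL n" and D: "D = GL_act n g B"
    by (auto simp: Orb_def)
  let ?h = "the (mat_inverse g)"
  have c: "g \<in> carrier_mat n n" "?h \<in> carrier_mat n n"
    using GL_inverse[OF g] g by (auto simp: GL_def)
  \<comment> \<open>Membership in \<open>algebras n\<close> ensures that products have length
    \<open>n\<close>, so that a coordinate of the matrix-vector product is a sum over
    \<open>i < n\<close>.\<close>
  have alg: "\<forall>\<^sub>F t in F. C t \<in> algebras n"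
    using C by eventually_elim (auto simp: Orb_def intro: GL_act_algebras[OF A])
  show "D \<in> zariski_closure n (Orb n A)"
  proof (rule tendsto_mem_zariski_closure[OF F, where C = "\<lambda>t. GL_act n g (C t)"])
    show "D \<in> algebras n"
      using GL_act_algebras[OF B g] D by simp
    show "\<forall>\<^sub>F t in F. GL_act n g (C t) \<in> Orb n A"
      using C by eventually_elim (rule GL_act_Orb[OF A g])
  next
    fix x y :: "complex vec" and k assume xy: "x \<in> carrier_vec n" "y \<in> carrier_vec n" and k: "k < n"
    have coord: "GL_act n g E x y $ k = (\<Sum>i<n. g $$ (k, i) * E (?h *\<^sub>v x) (?h *\<^sub>v y) $ i)"
      if "E \<in> algebras n" for E
      using xy k c algebras_closed[OF that, of "?h *\<^sub>v x" "?h *\<^sub>v y"]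
      by (auto simp: GL_act_def scalar_prod_def lessThan_atLeast0)
    have "((\<lambda>t. \<Sum>i<n. g $$ (k, i) * C t (?h *\<^sub>v x) (?h *\<^sub>v y) $ i) \<longlongrightarrow>
        (\<Sum>i<n. g $$ (k, i) * B (?h *\<^sub>v x) (?h *\<^sub>v y) $ i)) F"
      using c xy by (intro tendsto_intros lim) auto
    then show "((\<lambda>t. GL_act n g (C t) x y $ k) \<longlongrightarrow> D x y $ k) F"
      unfolding D coord[OF B]
      by (rule tendsto_cong[THEN iffD1, rotated]) (use alg in eventually_elim, simp add: coord)
  qed
qed

section \<open>Coordinates\<close>

text \<open>Collapses the double sum of \<open>mult_of_table\<close> when \<open>n\<close> is a
  variable; the tables of size 2 and 3 are expanded term by term instead.\<close>

lemma sum_sum_delta: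
  fixes x y :: "nat \<Rightarrow> 'a :: semiring_1"
  assumes "a < n" "b < n"
  shows "(\<Sum>i<n. \<Sum>j<n. x i * y j * (if i = a \<and> j = b then 1 else 0)) = x a * y b"
proof -
  have "(\<Sum>j<n. x i * y j * (if i = a \<and> j = b then 1 else 0)) = (if i = a then x a * y b else 0)" for i
    using assms by (simp add: if_distrib[of "(*) _"] cong: if_cong)
  then show ?thesis
    using assms by simp
qed

lemma algebrasI:
  assumes A: "A = (\<lambda>x \<in> carrier_vec n. \<lambda>y \<in> carrier_vec n. vec n (f x y))"
    and "\<And>x y z k. x \<in> carrier_vec n \<Longrightarrow> y \<in> carrier_vec n \<Longrightarrow> z \<in> carrier_vec n \<Longrightarrow> k < n \<Longrightarrow>
      f (x + y) z k = f x z k + f y z k"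
    and "\<And>x y z k. x \<in> carrier_vec n \<Longrightarrow> y \<in> carrier_vec n \<Longrightarrow> z \<in> carrier_vec n \<Longrightarrow> k < n \<Longrightarrow>
      f x (y + z) k = f x y k + f x z k"
    and "\<And>c x y k. x \<in> carrier_vec n \<Longrightarrow> y \<in> carrier_vec n \<Longrightarrow> k < n \<Longrightarrow>
      f (c \<cdot>\<^sub>v x) y k = c * f x y k"
    and "\<And>c x y k. x \<in> carrier_vec n \<Longrightarrow> y \<in> carrier_vec n \<Longrightarrow> k < n \<Longrightarrow>
      f x (c \<cdot>\<^sub>v y) k = c * f x y k"
  shows "A \<in> algebras n"
  unfolding algebras_def using assms by (auto intro!: eq_vecI)

lemma p_plus_eq:
  assumes "n \<ge> 2"
  shows "p_plus n = (\<lambda>x \<in> carrier_vec n. \<lambda>y \<in> carrier_vec n.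
    vec n (\<lambda>k. if k = 0 then 0 else x $ 0 * y $ k + x $ k * y $ 0))"
proof -
  have "(\<Sum>i<n. \<Sum>j<n. x $ i * y $ j *
      (if i = 0 \<and> 1 \<le> j then unit_vec n j else if 1 \<le> i \<and> j = 0 then unit_vec n i else 0\<^sub>v n) $ k)
    = (if k = 0 then 0 else x $ 0 * y $ k + x $ k * y $ 0)" (is "?l = ?r")
    if "k < n" for x y :: "complex vec" and k
  proof -
    \<comment> \<open>For \<open>k > 0\<close> only the table entries (0, k) and (k, 0) have a
      nonzero coordinate \<open>k\<close>, and they are distinct; no entry involves the basis vector
      of index 0.\<close>
    have "?l = (\<Sum>i<n. \<Sum>j<n. (if k = 0 then 0 else
        x $ i * y $ j * (if i = 0 \<and> j = k then 1 else 0) + x $ i * y $ j * (if i = k \<and> j = 0 then 1 else 0)))"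
      using that by (intro sum.cong refl) (auto simp: unit_vec_def)
    also have "\<dots> = ?r"
      using that assms by (cases "k = 0") (simp_all add: sum.distrib sum_sum_delta)
    finally show ?thesis .
  qed
  then show ?thesis
    unfolding p_plus_def mult_of_table_def by (auto simp: fun_eq_iff restrict_def intro!: eq_vecI)
qed

lemma lambda2_sum_eq:
  assumes "n \<ge> 2"
  shows "direct_sum 2 (n - 2) lambda2 (zero_algebra (n - 2)) =
    (\<lambda>x \<in> carrier_vec n. \<lambda>y \<in> carrier_vec n. vec n (\<lambda>k. if k = 1 then x $ 0 * y $ 0 else 0))"
proof -
  \<comment> \<open>\<open>direct_sum\<close> lives in dimension \<open>2 + (n - 2)\<close> with
    truncated subtraction.\<close>
  have "2 + (n - 2) = n"
    using assms by simp
  then show ?thesis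
    unfolding direct_sum_def lambda2_def zero_algebra_def mult_of_table_def
    using assms
    by (auto simp: fun_eq_iff restrict_def append_vec_def vec_first_def numeral_2_eq_2 less_Suc_eq
        intro!: eq_vecI)
qed

lemma n3_plus_sum_eq:
  assumes "n \<ge> 3"
  shows "direct_sum 3 (n - 3) n3_plus (zero_algebra (n - 3)) =
    (\<lambda>x \<in> carrier_vec n. \<lambda>y \<in> carrier_vec n.
      vec n (\<lambda>k. if k = 2 then x $ 0 * y $ 1 + x $ 1 * y $ 0 else 0))"
proof -
  have "3 + (n - 3) = n"
    using assms by simp
  then show ?thesis
    unfolding direct_sum_def n3_plus_def zero_algebra_def mult_of_table_def
    using assms
    by (auto simp: fun_eq_iff restrict_def append_vec_def vec_first_def numeral_3_eq_3 numeral_2_eq_2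
        less_Suc_eq intro!: eq_vecI)
qed

lemma p_plus_algebras: "n \<ge> 2 \<Longrightarrow> p_plus n \<in> algebras n"
  by (rule algebrasI[OF p_plus_eq]) (auto simp: algebra_simps)

lemma lambda2_sum_algebras:
  "n \<ge> 2 \<Longrightarrow> direct_sum 2 (n - 2) lambda2 (zero_algebra (n - 2)) \<in> algebras n"
  by (rule algebrasI[OF lambda2_sum_eq]) (auto simp: algebra_simps)

lemma n3_plus_sum_algebras:
  "n \<ge> 3 \<Longrightarrow> direct_sum 3 (n - 3) n3_plus (zero_algebra (n - 3)) \<in> algebras n"
  by (rule algebrasI[OF n3_plus_sum_eq]) (auto simp: algebra_simps)

section \<open>Explicit changes of basis and the two degenerations\<close>

lemma mat_of_row_fun_mult_vec:
  assumes "\<And>i. i < n \<Longrightarrow> r i \<in> carrier_vec n"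
  shows "mat\<^sub>r n n r *\<^sub>v x = vec n (\<lambda>i. r i \<bullet> x)"
  using assms by (intro eq_vecI) auto

text \<open>Testing on unit vectors recovers the columns. This turns the check that \<open>g\<close>
  inverts \<open>h\<close> into a calculation with the coordinate formulas for their
  actions.\<close>

lemma mat_eq_oneI:
  fixes A :: "'a :: semiring_1 mat"
  assumes A: "A \<in> carrier_mat n n" and "\<And>x. x \<in> carrier_vec n \<Longrightarrow> A *\<^sub>v x = x"
  shows "A = 1\<^sub>m n"
proof (rule eq_matI)
  fix i j assume ij: "i < dim_row (1\<^sub>m n :: 'a mat)" "j < dim_col (1\<^sub>m n :: 'a mat)"
  have "(A *\<^sub>v unit_vec n j) $ i = unit_vec n j $ i"
    using assms(2) by simp
  then show "A $$ (i, j) = 1\<^sub>m n $$ (i, j)"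
    using A ij by simp
qed (use A in auto)

text \<open>In the next two proofs \<open>h\<close> has the new basis vectors as columns and \<open>g\<close> is its inverse.\<close>

lemma p_plus_degenerates:
  assumes n: "n \<ge> 2"
  shows "degenerates n (p_plus n) (direct_sum 2 (n - 2) lambda2 (zero_algebra (n - 2)))"
proof -
  \<comment> \<open>The product in the new basis is exactly the target plus \<open>t\<close> times
    \<open>p_plus n\<close> itself, so the limit at 0 is visible from the formula.\<close>
  define C :: "complex \<Rightarrow> mult" where
    "C t = (\<lambda>x \<in> carrier_vec n. \<lambda>y \<in> carrier_vec n. vec n (\<lambda>k. (if k = 1 then x $ 0 * y $ 0 else 0) +
      t * (if k = 0 then 0 else x $ 0 * y $ k + x $ k * y $ 0)))" for t
  have orb: "C t \<in> Orb n (p_plus n)" if t: "t \<noteq> 0" for t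
  proof -
    let ?e = "unit_vec n :: nat \<Rightarrow> complex vec"
    \<comment> \<open>The matrix is entered by rows, so the coefficient 1/(2t) of the first new
      basis vector appears in row 1. It makes the two cross terms t * 1/(2t) of its square add up to
      1.\<close>
    define h where "h = mat\<^sub>r n n (\<lambda>i. if i = 0 then t \<cdot>\<^sub>v ?e 0
      else if i = 1 then (1 / (2 * t)) \<cdot>\<^sub>v ?e 0 + ?e 1 else ?e i)"
    \<comment> \<open>Solving for the old basis gives e_1 = f_1 / t - f_2 / (2 t^2).\<close>
    define g where "g = mat\<^sub>r n n (\<lambda>i. if i = 0 then (1 / t) \<cdot>\<^sub>v ?e 0
      else if i = 1 then (- 1 / (2 * t\<^sup>2)) \<cdot>\<^sub>v ?e 0 + ?e 1 else ?e i)"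
    have hx: "h *\<^sub>v x = vec n (\<lambda>i. if i = 0 then t * x $ 0
        else if i = 1 then x $ 0 / (2 * t) + x $ 1 else x $ i)" if "x \<in> carrier_vec n" for x
      unfolding h_def using n that
      by (subst mat_of_row_fun_mult_vec)
        (auto simp: add_scalar_prod_distrib[of _ n] intro!: eq_vecI)
    have gx: "g *\<^sub>v x = vec n (\<lambda>i. if i = 0 then x $ 0 / t
        else if i = 1 then - x $ 0 / (2 * t\<^sup>2) + x $ 1 else x $ i)" if "x \<in> carrier_vec n" for x
      unfolding g_def using n that
      by (subst mat_of_row_fun_mult_vec)
        (auto simp: add_scalar_prod_distrib[of _ n] intro!: eq_vecI)
    have carrier: "g \<in> carrier_mat n n" "h \<in> carrier_mat n n"
      by (auto simp: g_def h_def)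
    have "g * h = 1\<^sub>m n"
    proof (rule mat_eq_oneI)
      fix x :: "complex vec" assume "x \<in> carrier_vec n"
      then show "g * h *\<^sub>v x = x"
        using carrier n t
        by (auto simp: assoc_mult_mat_vec[of _ n n _ n] gx hx field_simps power2_eq_square intro!: eq_vecI)
    qed (use carrier in auto)
    then show ?thesis
    proof (rule OrbI[OF carrier])
      show "C t = (\<lambda>x \<in> carrier_vec n. \<lambda>y \<in> carrier_vec n. g *\<^sub>v p_plus n (h *\<^sub>v x) (h *\<^sub>v y))"
        using n t
        by (auto simp: C_def p_plus_eq fun_eq_iff restrict_def gx hx field_simps intro!: eq_vecI)
    qed
  qed
  show ?thesis
  proof (rule degenerates_limit[where F = "at 0" and C = C])
    \<comment> \<open>The filter \<open>at 0\<close> leaves out the point 0 itself, where the change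
      of basis breaks down.\<close>
    show "\<forall>\<^sub>F t in at 0. C t \<in> Orb n (p_plus n)"
      using orb by (auto simp: eventually_at_filter)
  next
    fix x y :: "complex vec" and k assume "x \<in> carrier_vec n" "y \<in> carrier_vec n" "k < n"
    then show "((\<lambda>t. C t x y $ k) \<longlongrightarrow>
        direct_sum 2 (n - 2) lambda2 (zero_algebra (n - 2)) x y $ k) (at 0)"
      unfolding C_def lambda2_sum_eq[OF n] by (auto intro!: tendsto_eq_intros)
  qed (use n in \<open>auto intro: p_plus_algebras lambda2_sum_algebras\<close>)
qed

lemma n3_plus_sum_degenerates:
  assumes n: "n \<ge> 3"
  shows "degenerates n (direct_sum 3 (n - 3) n3_plus (zero_algebra (n - 3)))
    (direct_sum 2 (n - 2) lambda2 (zero_algebra (n - 2)))"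
proof -
  \<comment> \<open>All products now land in index 1, because e_3 has become the second basis
    vector; the term with \<open>t\<close> comes from f_1 f_3 = f_3 f_1 = t f_2.\<close>
  define C :: "complex \<Rightarrow> mult" where
    "C t = (\<lambda>x \<in> carrier_vec n. \<lambda>y \<in> carrier_vec n. vec n (\<lambda>k. if k = 1
      then x $ 0 * y $ 0 + t * (x $ 0 * y $ 2 + x $ 2 * y $ 0) else 0))" for t
  let ?A = "direct_sum 3 (n - 3) n3_plus (zero_algebra (n - 3))"
  have orb: "C t \<in> Orb n ?A" if t: "t \<noteq> 0" for t
  proof -
    let ?e = "unit_vec n :: nat \<Rightarrow> complex vec"
    \<comment> \<open>The entry 1/2 makes the two cross terms of the square of f_1 add up to e_3.
      Scaling e_2 by \<open>t\<close> makes its product with f_1 vanish in the limit, while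
      \<open>h\<close> stays invertible for nonzero \<open>t\<close>.\<close>
    define h where "h = mat\<^sub>r n n (\<lambda>i. if i = 1 then (1 / 2) \<cdot>\<^sub>v ?e 0 + t \<cdot>\<^sub>v ?e 2
      else if i = 2 then ?e 1 else ?e i)"
    \<comment> \<open>Read off from e_1 = f_1 - f_3 / (2t), e_2 = f_3 / t and e_3 = f_2.\<close>
    define g where "g = mat\<^sub>r n n (\<lambda>i. if i = 1 then ?e 2
      else if i = 2 then (- 1 / (2 * t)) \<cdot>\<^sub>v ?e 0 + (1 / t) \<cdot>\<^sub>v ?e 1 else ?e i)"
    have hx: "h *\<^sub>v x = vec n (\<lambda>i. if i = 1 then x $ 0 / 2 + t * x $ 2
        else if i = 2 then x $ 1 else x $ i)" if "x \<in> carrier_vec n" for x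
      unfolding h_def using n that
      by (subst mat_of_row_fun_mult_vec)
        (auto simp: add_scalar_prod_distrib[of _ n] intro!: eq_vecI)
    have gx: "g *\<^sub>v x = vec n (\<lambda>i. if i = 1 then x $ 2
        else if i = 2 then - x $ 0 / (2 * t) + x $ 1 / t else x $ i)" if "x \<in> carrier_vec n" for x
      unfolding g_def using n that
      by (subst mat_of_row_fun_mult_vec)
        (auto simp: add_scalar_prod_distrib[of _ n] intro!: eq_vecI)
    have carrier: "g \<in> carrier_mat n n" "h \<in> carrier_mat n n"
      by (auto simp: g_def h_def)
    have "g * h = 1\<^sub>m n"
    proof (rule mat_eq_oneI)
      fix x :: "complex vec" assume "x \<in> carrier_vec n"
      then show "g * h *\<^sub>v x = x"
        using carrier n t
        by (auto simp: assoc_mult_mat_vec[of _ n n _ n] gx hx field_simps intro!: eq_vecI)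
    qed (use carrier in auto)
    then show ?thesis
    proof (rule OrbI[OF carrier])
      show "C t = (\<lambda>x \<in> carrier_vec n. \<lambda>y \<in> carrier_vec n. g *\<^sub>v ?A (h *\<^sub>v x) (h *\<^sub>v y))"
        using n t
        by (auto simp: C_def n3_plus_sum_eq fun_eq_iff restrict_def gx hx field_simps intro!: eq_vecI)
    qed
  qed
  have n2: "n \<ge> 2"
    using n by simp
  show ?thesis
  proof (rule degenerates_limit[where F = "at 0" and C = C])
    show "\<forall>\<^sub>F t in at 0. C t \<in> Orb n ?A"
      using orb by (auto simp: eventually_at_filter)
  next
    fix x y :: "complex vec" and k assume "x \<in> carrier_vec n" "y \<in> carrier_vec n" "k < n"
    then show "((\<lambda>t. C t x y $ k) \<longlongrightarrow>
        direct_sum 2 (n - 2) lambda2 (zero_algebra (n - 2)) x y $ k) (at 0)"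
      unfolding C_def lambda2_sum_eq[OF n2] by (auto intro!: tendsto_eq_intros)
  qed (use n n2 in \<open>auto intro: n3_plus_sum_algebras lambda2_sum_algebras\<close>)
qed

theorem proposition2p1:
  shows "(\<forall>n\<ge>2. degenerates n (p_plus n) (direct_sum 2 (n - 2) lambda2 (zero_algebra (n - 2)))) \<and>
    (\<forall>n\<ge>3. degenerates n (direct_sum 3 (n - 3) n3_plus (zero_algebra (n - 3)))
                        (direct_sum 2 (n - 2) lambda2 (zero_algebra (n - 2))))"
  using p_plus_degenerates n3_plus_sum_degenerates by blast

end
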